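(* Let $p$ be an odd prime and $r\geq 1$ an integer. Then $O\chi_{\frac{p^r+1}{2}}(QR(p^{2r}))=p^r$.
   Context: For a prime power $q$, $\mathbb{F}_q$ is the finite field of order $q$. The Paley graph $QR(q)$ is the Cayley graph $\Gamma(\mathbb{F}_q,S)$ where $S=\{\alpha^{2m}:1\le m\le \frac{q-1}{2}\}$ is the set of nonzero squares in $\mathbb{F}_q$ ($\alpha$ a primitive element); its vertex set is $\mathbb{F}_q$ and $u,v$ are adjacent iff $u-v\in S$. All colourings are proper vertex colourings. Two colourings are orthogonal if whenever two distinct vertices receive the same colour in one, they receive distinct colours in the other. A $k$-orthogonal colouring is a collection of $k$ pairwise orthogonal proper colourings, and $O\chi_k(G)$ is the minimum number of colours needed for a $k$-orthogonal colouring of $G$. *)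

theory Defs
  imports
    "Graph_Theory.Pair_Digraph"
    "HOL-Algebra.Multiplicative_Group"
    "HOL-Computational_Algebra.Primes"
begin

definition additive_cayley_graph ::
    "('a, 'm) ring_scheme \<Rightarrow> 'a set \<Rightarrow> 'a pair_pre_digraph" where
  "additive_cayley_graph R S =
     \<lparr> pverts = carrier R,
       parcs = {(u, v). u \<in> carrier R \<and> v \<in> carrier R \<and> u \<ominus>\<^bsub>R\<^esub> v \<in> S} \<rparr>"

definition nonzero_squares :: "('a, 'm) ring_scheme \<Rightarrow> 'a set" where
  "nonzero_squares R = {x \<otimes>\<^bsub>R\<^esub> x | x. x \<in> carrier R - {\<zero>\<^bsub>R\<^esub>}}"

definition paley_graph :: "('a, 'm) ring_scheme \<Rightarrow> 'a pair_pre_digraph" where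
  "paley_graph F = additive_cayley_graph F (nonzero_squares F)"

context field
begin

lemma pow_card_minus_1:
  assumes "finite (carrier R)" and "a \<in> carrier R - {\<zero>}"
  shows "a [^] (card (carrier R) - 1) = \<one>"
proof -
  interpret G: group "mult_of R" by (rule field_mult_group)
  have "a [^]\<^bsub>mult_of R\<^esub> order (mult_of R) = \<one>\<^bsub>mult_of R\<^esub>"
    using assms by (intro G.pow_order_eq_1) auto
  then show ?thesis
    using assms by (simp add: order_def card_Diff_singleton nat_pow_mult_of)
qed

text \<open>
  In terms of a primitive element \<open>a\<close>, the connection set consists of the even powers of \<open>a\<close>.
\<close>

lemma nonzero_squares_eq_even_powers:
  assumes fin: "finite (carrier R)" and odd: "odd (card (carrier R))"
    and a: "a \<in> carrier (mult_of R)"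
    and gen: "carrier (mult_of R) = {a [^] i | i :: nat. i \<in> UNIV}"
  shows "nonzero_squares R =
    {a [^] (2 * m) | m :: nat. 1 \<le> m \<and> m \<le> (card (carrier R) - 1) div 2}" (is "_ = ?E")
proof -
  define h where "h = (card (carrier R) - 1) div 2"
  have ac: "a \<in> carrier R" using a by simp
  have q: "card (carrier R) - 1 = 2 * h" using odd by (simp add: h_def)
  have "card {\<zero>, \<one>} \<le> card (carrier R)" using fin by (intro card_mono) auto
  then have h: "h \<ge> 1" using q odd by (cases "h = 0") auto
  have per: "a [^] (2 * h) = \<one>" using pow_card_minus_1[OF fin] a q by simp
  have sq: "a [^] i \<otimes> a [^] i = a [^] (2 * i)" for i :: nat
    using ac by (simp add: nat_pow_mult mult_2)
  show ?thesis
  proof (intro equalityI subsetI)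
    fix y assume "y \<in> nonzero_squares R"
    then obtain x where x: "x \<in> carrier (mult_of R)" "y = x \<otimes> x"
      by (auto simp: nonzero_squares_def)
    then obtain i :: nat where i: "x = a [^] i" using gen by auto
    define m where "m = (if i mod h = 0 then h else i mod h)"
    have red: "a [^] (2 * i) = a [^] (2 * (i mod h))"
    proof -
      have "2 * i = 2 * h * (i div h) + 2 * (i mod h)"
        by (metis distrib_left mult.assoc mult_div_mod_eq)
      then have "a [^] (2 * i) = (a [^] (2 * h)) [^] (i div h) \<otimes> a [^] (2 * (i mod h))"
        using ac by (simp add: nat_pow_mult nat_pow_pow)
      then show ?thesis using ac per by simp
    qed
    have "y = a [^] (2 * m)" using x i sq red per by (auto simp: m_def)
    moreover have "1 \<le> m" "m \<le> h" using h by (auto simp: m_def less_imp_le)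
    ultimately show "y \<in> ?E" by (auto simp: h_def)
  next
    fix y assume "y \<in> ?E"
    then obtain m :: nat where m: "y = a [^] (2 * m)" by auto
    have "a [^] m \<in> carrier (mult_of R)" unfolding gen by auto
    then show "y \<in> nonzero_squares R"
      using m sq[of m] unfolding nonzero_squares_def by force
  qed
qed

lemma minus_one_square:
  assumes fin: "finite (carrier R)" and q4: "card (carrier R) mod 4 = 1"
  obtains b where "b \<in> carrier R" "b \<noteq> \<zero>" "b \<otimes> b = \<ominus> \<one>"
proof -
  obtain a where a: "a \<in> carrier (mult_of R)"
    and gen: "carrier (mult_of R) = {a [^] i | i :: nat. i \<in> UNIV}"
    using finite_field_mult_group_has_gen[OF fin] by blast
  have ac: "a \<in> carrier R" using a by simp
  define l where "l = card (carrier R) div 4"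
  have q: "card (carrier R) - 1 = 4 * l" using q4 unfolding l_def by presburger
  have "card {\<zero>, \<one>} \<le> card (carrier R)" using fin by (intro card_mono) auto
  then have l: "l \<ge> 1" using q by (cases "l = 0") auto
  have cm: "card (carrier (mult_of R)) = 4 * l" using fin q by (simp add: card_Diff_singleton)
  define c where "c = a [^] (2 * l)"
  have cc: "c \<in> carrier R" using ac by (simp add: c_def)
  have "c \<otimes> c = a [^] (4 * l)" using ac by (simp add: c_def nat_pow_mult)
  then have c2: "c \<otimes> c = \<one>" using pow_card_minus_1[OF fin] a q by simp
  have "c \<noteq> \<one>"
  proof
    assume c1: "c = \<one>"
    have "carrier (mult_of R) \<subseteq> (\<lambda>i. a [^] i) ` {..<2 * l}"
    proof
      fix x assume "x \<in> carrier (mult_of R)"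
      then obtain i :: nat where i: "x = a [^] i" using gen by auto
      have "a [^] i = a [^] (2 * l * (i div (2 * l)) + i mod (2 * l))" by simp
      also have "\<dots> = (a [^] (2 * l)) [^] (i div (2 * l)) \<otimes> a [^] (i mod (2 * l))"
        using ac by (simp only: nat_pow_mult nat_pow_pow nat_pow_closed)
      also have "\<dots> = a [^] (i mod (2 * l))" using c1 ac by (simp add: c_def)
      finally show "x \<in> (\<lambda>i. a [^] i) ` {..<2 * l}" using i l by auto
    qed
    then have "card (carrier (mult_of R)) \<le> card {..<2 * l}"
      by (meson card_image_le card_mono finite_imageI finite_lessThan le_trans)
    then show False using cm l by simp
  qed
  moreover have "(c \<ominus> \<one>) \<otimes> (c \<oplus> \<one>) = \<zero>"
  proof -
    have "(c \<ominus> \<one>) \<otimes> (c \<oplus> \<one>) = c \<otimes> c \<ominus> \<one>" using cc by algebra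
    then show ?thesis using c2 by (simp add: a_minus_def r_neg)
  qed
  ultimately have "c \<oplus> \<one> = \<zero>"
    using cc integral[of "c \<ominus> \<one>" "c \<oplus> \<one>"] by (auto simp: r_right_minus_eq)
  then have "c = \<ominus> \<one>" using cc by (simp add: minus_equality)
  moreover have "a [^] l \<otimes> a [^] l = c" using ac by (simp add: c_def nat_pow_mult mult_2)
  moreover have "a [^] l \<in> carrier (mult_of R)" unfolding gen by auto
  ultimately show ?thesis using that[of "a [^] l"] by simp
qed

text \<open>
  The Paley graph is a finite simple undirected graph; \<open>q mod 4 = 1\<close> is what makes adjacency
  symmetric, and it holds for every even power \<open>q\<close> of an odd prime.
\<close>

lemma pair_graph_paley_graph:
  assumes fin: "finite (carrier R)" and q4: "card (carrier R) mod 4 = 1"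
  shows "pair_graph (paley_graph R)"
proof -
  let ?E = "parcs (paley_graph R)"
  have E: "?E = {(u, v). u \<in> carrier R \<and> v \<in> carrier R \<and> u \<ominus> v \<in> nonzero_squares R}"
    and V: "pverts (paley_graph R) = carrier R"
    by (auto simp: paley_graph_def additive_cayley_graph_def)
  obtain b where b: "b \<in> carrier R" "b \<noteq> \<zero>" "b \<otimes> b = \<ominus> \<one>"
    using minus_one_square[OF fin q4] .
  have "sym ?E"
  proof (rule symI)
    fix u v assume "(u, v) \<in> ?E"
    then obtain x where uv: "u \<in> carrier R" "v \<in> carrier R"
      and x: "x \<in> carrier R" "x \<noteq> \<zero>" "u \<ominus> v = x \<otimes> x"
      unfolding E nonzero_squares_def by auto
    have "v \<ominus> u = \<ominus> \<one> \<otimes> (u \<ominus> v)" using uv by algebra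
    also have "\<dots> = (b \<otimes> b) \<otimes> (x \<otimes> x)" using b x by simp
    also have "\<dots> = (b \<otimes> x) \<otimes> (b \<otimes> x)" using b(1) x(1) by (simp add: m_ac)
    finally have "v \<ominus> u = (b \<otimes> x) \<otimes> (b \<otimes> x)" .
    moreover have "b \<otimes> x \<in> carrier R" "b \<otimes> x \<noteq> \<zero>" using b x integral by auto
    ultimately show "(v, u) \<in> ?E" unfolding E nonzero_squares_def using uv by blast
  qed
  moreover have "\<zero> \<notin> nonzero_squares R" unfolding nonzero_squares_def
    using integral by force
  then have "fst e \<noteq> snd e" if "e \<in> ?E" for e using that unfolding E
    by (auto simp: a_minus_def r_neg)
  moreover have "finite ?E"
    by (rule finite_subset[of _ "carrier R \<times> carrier R"]) (auto simp: E fin)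
  ultimately show ?thesis
    by unfold_locales (auto simp: E V fin symmetric_def)
qed

end

definition proper_colouring :: "'v pair_pre_digraph \<Rightarrow> nat \<Rightarrow> ('v \<Rightarrow> nat) \<Rightarrow> bool" where
  "proper_colouring G n c \<longleftrightarrow>
     (\<forall>v \<in> pverts G. c v < n) \<and> (\<forall>(u, v) \<in> parcs G. c u \<noteq> c v)"

definition orthogonal_colourings ::
    "'v pair_pre_digraph \<Rightarrow> ('v \<Rightarrow> nat) \<Rightarrow> ('v \<Rightarrow> nat) \<Rightarrow> bool" where
  "orthogonal_colourings G c d \<longleftrightarrow>
     (\<forall>u \<in> pverts G. \<forall>v \<in> pverts G. u \<noteq> v \<longrightarrow>
        (c u = c v \<longrightarrow> d u \<noteq> d v) \<and> (d u = d v \<longrightarrow> c u \<noteq> c v))"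

text \<open>
  The \<open>k\<close> colourings \<open>c 0, \<dots>, c (k - 1)\<close> share one palette of \<open>n\<close> colours.
\<close>

definition orthogonal_colouring ::
    "'v pair_pre_digraph \<Rightarrow> nat \<Rightarrow> nat \<Rightarrow> (nat \<Rightarrow> 'v \<Rightarrow> nat) \<Rightarrow> bool" where
  "orthogonal_colouring G k n c \<longleftrightarrow>
     (\<forall>i < k. proper_colouring G n (c i)) \<and>
     (\<forall>i < k. \<forall>j < k. i \<noteq> j \<longrightarrow> orthogonal_colourings G (c i) (c j))"

text \<open>
  On a finite loopless graph the minimum exists, since an injective colouring is proper and is
  orthogonal to every colouring, itself included.
\<close>

definition orthogonal_chromatic_number :: "nat \<Rightarrow> 'v pair_pre_digraph \<Rightarrow> nat" where
  "orthogonal_chromatic_number k G = (LEAST n. \<exists>c. orthogonal_colouring G k n c)"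

end

theory Submission
  imports Defs "HOL-Number_Theory.Cong"
begin

text \<open>
  Write \<open>q = p ^ r\<close>. The elements fixed by
  \<open>x \<mapsto> x ^ q\<close> form a subfield \<open>K\<close> of order \<open>q\<close>, all of whose nonzero elements are squares, so the
  line \<open>b K\<close> through a nonsquare \<open>b\<close> contains no nonzero square. Hence colouring the vertices by
  the cosets of \<open>b K\<close> is proper, and lines in different directions meet only in \<open>0\<close>, so the
  \<open>(q + 1) / 2\<close> nonsquare directions give pairwise orthogonal colourings. The coset of \<open>v\<close> is read
  off the additive map \<open>v \<mapsto> v ^ q b - v b ^ q\<close>, whose kernel is \<open>b K\<close> and whose values all satisfy
  \<open>y ^ q = - y\<close>, an equation with at most \<open>q\<close> solutions. Conversely, two orthogonal colourings
  with \<open>n\<close> colours embed the \<open>q ^ 2\<close> vertices into the \<open>n ^ 2\<close> pairs of colours.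
\<close>

section \<open>The Frobenius map\<close>

text \<open>Absorption gives \<open>k * (p choose k) = p * (p - 1 choose k - 1)\<close>, and
  \<open>p\<close> cannot divide the smaller positive factor \<open>k\<close>.\<close>

lemma prime_dvd_binomial:
  fixes p :: nat
  assumes "Factorial_Ring.prime p" "0 < k" "k < p"
  shows "p dvd (p choose k)"
proof -
  have "p dvd k * (p choose k)"
    using times_binomial_minus1_eq[of k p] assms(2) by simp
  moreover have "\<not> p dvd k" using assms(2,3) by (auto dest: dvd_imp_le)
  ultimately show ?thesis using assms(1) by (simp add: prime_dvd_mult_iff)
qed

lemma (in cring) binomial_theorem:
  fixes n :: nat
  assumes x: "x \<in> carrier R" and y: "y \<in> carrier R"
  shows "(x \<oplus> y) [^] n = (\<Oplus>k\<in>{..n}. [(n choose k)] \<cdot> (x [^] k \<otimes> y [^] (n - k)))"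
proof (induction n)
  case 0
  then show ?case by simp
next
  case (Suc n)
  define S where "S = (\<Oplus>k\<in>{..n}. [(n choose k)] \<cdot> (x [^] k \<otimes> y [^] (n - k)))"
  \<comment> \<open>\<open>g\<close> holds the terms produced by the factor \<open>x\<close>,
    shifted by one index, and \<open>h\<close> those produced by \<open>y\<close>; Pascal's rule
    adds them up. The coefficient at \<open>k = 0\<close> is set to 0 explicitly, since
    \<open>k - 1\<close> truncates to 0 there and would yield 1.\<close>
  define g where "g k = [(if k = 0 then 0 else n choose (k - 1))] \<cdot> (x [^] k \<otimes> y [^] (Suc n - k))"
    for k :: nat
  define h where "h k = [(n choose k)] \<cdot> (x [^] k \<otimes> y [^] (Suc n - k))" for k :: nat
  have S: "S \<in> carrier R" and g: "g k \<in> carrier R" and h: "h k \<in> carrier R" for k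
    using x y by (auto simp: S_def g_def h_def)
  have "S \<otimes> x = (\<Oplus>k\<in>{..n}. g (Suc k))"
    unfolding S_def using x y
    by (subst finsum_ldistr)
       (auto intro!: finsum_cong' simp: g_def add_pow_ldistr add_pow_rdistr m_ac)
  also have "\<dots> = (\<Oplus>k\<in>{..n}. g (Suc k)) \<oplus> g 0"
    using g x y by (simp add: g_def)
  also have "\<dots> = (\<Oplus>k\<in>{..Suc n}. g k)"
    using g by (simp add: finsum_Suc2 del: finsum_Suc)
  finally have Sx: "S \<otimes> x = (\<Oplus>k\<in>{..Suc n}. g k)" .
  have "S \<otimes> y = (\<Oplus>k\<in>{..n}. h k)"
    unfolding S_def using x y
    by (subst finsum_ldistr)
       (auto intro!: finsum_cong' simp: h_def add_pow_ldistr m_assoc Suc_diff_le)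
  also have "\<dots> = (\<Oplus>k\<in>{..Suc n}. h k)"
  proof -
    have "h (Suc n) = \<zero>" using x y by (simp add: h_def binomial_eq_0)
    then show ?thesis using h by simp
  qed
  finally have Sy: "S \<otimes> y = (\<Oplus>k\<in>{..Suc n}. h k)" .
  have "(x \<oplus> y) [^] Suc n = S \<otimes> x \<oplus> S \<otimes> y"
    using Suc S x y by (simp add: S_def r_distr)
  also have "\<dots> = (\<Oplus>k\<in>{..Suc n}. g k \<oplus> h k)"
    unfolding Sx Sy using g h by (intro finsum_addf[symmetric]) auto
  also have "\<dots> = (\<Oplus>k\<in>{..Suc n}. [(Suc n choose k)] \<cdot> (x [^] k \<otimes> y [^] (Suc n - k)))"
  proof (intro finsum_cong' refl)
    fix k
    have "(if k = 0 then 0 else n choose (k - 1)) + (n choose k) = Suc n choose k"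
      by (cases k) auto
    then show "g k \<oplus> h k = [(Suc n choose k)] \<cdot> (x [^] k \<otimes> y [^] (Suc n - k))"
      unfolding g_def h_def using x y by (subst add.nat_pow_mult) auto
  qed (use x y in auto)
  finally show ?case .
qed

text \<open>In the binomial expansion every coefficient strictly between the two ends is a multiple
  of \<open>p\<close> and hence vanishes, so only the indices 0 and \<open>p\<close>
  survive.\<close>

lemma (in cring) frobenius_add:
  fixes p :: nat
  assumes p: "Factorial_Ring.prime p" and char: "[p] \<cdot> \<one> = \<zero>"
    and x: "x \<in> carrier R" and y: "y \<in> carrier R"
  shows "(x \<oplus> y) [^] p = x [^] p \<oplus> y [^] p"
proof -
  define t where "t k = [(p choose k)] \<cdot> (x [^] k \<otimes> y [^] (p - k))" for k :: nat
  have t: "t k \<in> carrier R" for k using x y by (auto simp: t_def)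
  have vanish: "[(p * m)] \<cdot> z = \<zero>" if "z \<in> carrier R" for m :: nat and z
  proof -
    have "[p] \<cdot> z = \<zero>" using add_pow_ldistr[of \<one> z p] that char by simp
    then show ?thesis using add.nat_pow_pow[of z m p] that by simp
  qed
  have t0: "t k = \<zero>" if "0 < k" "k < p" for k
    using prime_dvd_binomial[OF p that] x y by (auto simp: t_def vanish elim!: dvdE)
  obtain m where m: "p = Suc m" using prime_gt_0_nat[OF p] by (cases p) auto
  have "(x \<oplus> y) [^] p = (\<Oplus>k\<in>{..Suc m}. t k)"
    using binomial_theorem[OF x y, of p] by (simp add: t_def m)
  also have "\<dots> = t p \<oplus> (\<Oplus>k\<in>{..m}. t k)" using t by (simp add: m)
  also have "(\<Oplus>k\<in>{..m}. t k) = (\<Oplus>k\<in>{..m}. if 0 = k then t k else \<zero>)"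
    using t t0 m by (intro finsum_cong') auto
  also have "\<dots> = t 0" using t by (subst add.finprod_singleton) auto
  finally show ?thesis using x y by (simp add: t_def)
qed

lemma (in cring) frobenius_power_add:
  fixes p r :: nat
  assumes "Factorial_Ring.prime p" "[p] \<cdot> \<one> = \<zero>" "x \<in> carrier R" "y \<in> carrier R"
  shows "(x \<oplus> y) [^] (p ^ r) = x [^] (p ^ r) \<oplus> y [^] (p ^ r)"
proof (induction r)
  case 0
  then show ?case using assms by (simp add: nat_pow_eone)
next
  case (Suc r)
  have "(x \<oplus> y) [^] (p ^ Suc r) = ((x \<oplus> y) [^] (p ^ r)) [^] p"
    using assms by (simp add: nat_pow_pow mult.commute)
  also have "\<dots> = (x [^] (p ^ r)) [^] p \<oplus> (y [^] (p ^ r)) [^] p"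
    using Suc frobenius_add assms by simp
  finally show ?case using assms by (simp add: nat_pow_pow mult.commute)
qed

text \<open>Applying additivity to \<open>(x \<ominus> y) \<oplus> y\<close> avoids evaluating a
  power of minus one, whose sign would depend on the parity of \<open>p\<close>.\<close>

lemma (in cring) frobenius_power_minus:
  fixes p r :: nat
  assumes "Factorial_Ring.prime p" "[p] \<cdot> \<one> = \<zero>" "x \<in> carrier R" "y \<in> carrier R"
  shows "(x \<ominus> y) [^] (p ^ r) = x [^] (p ^ r) \<ominus> y [^] (p ^ r)"
proof -
  have "(x \<ominus> y) [^] (p ^ r) \<oplus> y [^] (p ^ r) = ((x \<ominus> y) \<oplus> y) [^] (p ^ r)"
    using assms by (intro frobenius_power_add[symmetric]) auto
  also have "(x \<ominus> y) \<oplus> y = x" using assms by algebra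
  finally have eq: "(x \<ominus> y) [^] (p ^ r) \<oplus> y [^] (p ^ r) = x [^] (p ^ r)" .
  have "u = (u \<oplus> w) \<ominus> w" if "u \<in> carrier R" "w \<in> carrier R" for u w
    using that by algebra
  then have "(x \<ominus> y) [^] (p ^ r)
      = ((x \<ominus> y) [^] (p ^ r) \<oplus> y [^] (p ^ r)) \<ominus> y [^] (p ^ r)"
    using assms by simp
  then show ?thesis unfolding eq .
qed

text \<open>The order of the additive group annihilates the unit. As
  \<open>[(p ^ n)] \<cdot> \<one>\<close> is the \<open>n\<close>-th power of
  \<open>[p] \<cdot> \<one>\<close> and there are no zero divisors, the latter must vanish.\<close>

lemma (in field) char_of_prime_power_card:
  fixes p n :: nat
  assumes "card (carrier R) = p ^ n"
  shows "[p] \<cdot> \<one> = \<zero>"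
proof -
  have "[order (add_monoid R)] \<cdot> \<one> = \<zero>"
    using add.pow_order_eq_1[of \<one>] by simp
  then have "[(p ^ n)] \<cdot> \<one> = \<zero>" using assms by (simp add: order_def)
  then show ?thesis
  proof (induction n)
    case 0
    then show ?case by simp
  next
    case (Suc n)
    have "[(p ^ Suc n)] \<cdot> \<one> = [p] \<cdot> ([(p ^ n)] \<cdot> \<one>)"
      using add.nat_pow_pow[of \<one> p "p ^ n"] by (simp add: mult.commute)
    also have "\<dots> = ([p] \<cdot> \<one>) \<otimes> ([(p ^ n)] \<cdot> \<one>)"
      using add_pow_ldistr[of \<one> "[(p ^ n)] \<cdot> \<one>" p] by simp
    finally show ?case using Suc integral by auto
  qed
qed

section \<open>Finite fields\<close>

lemma (in field) generator_pow_eq_imp_cong: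
  fixes m n :: nat
  assumes fin: "finite (carrier R)" and a: "a \<in> carrier (mult_of R)"
    and gen: "carrier (mult_of R) = {a [^] i | i :: nat. i \<in> UNIV}"
    and eq: "a [^] m = a [^] n"
  shows "[m = n] (mod (card (carrier R) - 1))"
proof -
  interpret G: group "mult_of R" by (rule field_mult_group)
  have fin': "finite (carrier (mult_of R))" using fin by (rule finite_mult_of)
  have "generate (mult_of R) {a} = carrier (mult_of R)"
    using G.generate_pow_on_finite_carrier[OF fin' a] gen by (auto simp: nat_pow_mult_of)
  then have ord: "G.ord a = card (carrier R) - 1"
    using G.generate_pow_card[OF a] fin by (simp add: card_Diff_singleton)
  \<comment> \<open>Subtraction is truncated, so one of these two facts is trivial; together they
    cover both orders of \<open>m\<close> and \<open>n\<close>.\<close>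
  have "G.ord a dvd m - n" "G.ord a dvd n - m"
    using G.pow_eq_div2[OF a, of m n] G.pow_eq_div2[OF a, of n m] eq G.pow_eq_id[OF a]
    by (auto simp: nat_pow_mult_of)
  then show ?thesis
    unfolding ord by (metis cong_altdef_nat cong_sym nat_le_linear)
qed

lemma (in field) pow_card:
  assumes "finite (carrier R)" "x \<in> carrier R"
  shows "x [^] card (carrier R) = x"
proof -
  have c: "card (carrier R) = Suc (card (carrier R) - 1)"
    using assms by (metis Suc_pred' card_gt_0_iff empty_iff)
  show ?thesis
  proof (cases "x = \<zero>")
    case True
    then show ?thesis by (subst c) simp
  next
    case False
    then show ?thesis using assms pow_card_minus_1[of x] by (subst c) simp
  qed
qed

text \<open>Dividing by one fixed nonzero solution \<open>z\<close> turns every nonzero solution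
  into a root of \<open>x [^] (d - 1) = \<one>\<close>. There are at most \<open>d - 1\<close> such
  roots, and zero contributes one more solution.\<close>

lemma (in field) card_pow_eq_uminus_le:
  assumes fin: "finite (carrier R)" and d: "d > 1"
  shows "card {x \<in> carrier R. x [^] d = \<ominus> x} \<le> d"
proof (cases "\<exists>z \<in> carrier R - {\<zero>}. z [^] d = \<ominus> z")
  case False
  then have "{x \<in> carrier R. x [^] d = \<ominus> x} \<subseteq> {\<zero>}" by auto
  then have "card {x \<in> carrier R. x [^] d = \<ominus> x} \<le> card {\<zero>}" by (intro card_mono) auto
  then show ?thesis using d by simp
next
  case True
  then obtain z where z: "z \<in> carrier R" "z \<noteq> \<zero>" "z [^] d = \<ominus> z" by auto
  define U where "U = {x \<in> carrier R. x [^] (d - 1) = \<one>}"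
  obtain e where e: "d = Suc e" using d by (cases d) auto
  have zi: "inv z \<in> carrier R" "z \<otimes> inv z = \<one>"
    using z field_Units by auto
  have nz: "z [^] e = \<ominus> \<one>" if "z \<in> carrier R" "z \<noteq> \<zero>" "z [^] d = \<ominus> z" for z
  proof -
    have "z [^] e \<otimes> z = \<ominus> \<one> \<otimes> z" using that e by (simp add: l_minus)
    then show ?thesis using that m_rcancel[of z "z [^] e" "\<ominus> \<one>"] by simp
  qed
  have "{x \<in> carrier R. x [^] d = \<ominus> x} \<subseteq> insert \<zero> ((\<lambda>u. u \<otimes> z) ` U)"
  proof
    fix x assume "x \<in> {x \<in> carrier R. x [^] d = \<ominus> x}"
    then have x: "x \<in> carrier R" "x [^] d = \<ominus> x" by auto
    show "x \<in> insert \<zero> ((\<lambda>u. u \<otimes> z) ` U)"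
    proof (cases "x = \<zero>")
      case False
      have "(x \<otimes> inv z) [^] e = x [^] e \<otimes> (inv z) [^] e"
        using x zi by (simp add: nat_pow_distrib)
      also have "\<dots> = z [^] e \<otimes> (inv z) [^] e" using nz x False z by simp
      also have "\<dots> = (z \<otimes> inv z) [^] e" using z zi by (intro nat_pow_distrib[symmetric])
      finally have "x \<otimes> inv z \<in> U" using x zi by (simp add: U_def e)
      moreover have "x = (x \<otimes> inv z) \<otimes> z" using x z zi m_lcomm[of z x "inv z"] by (simp add: m_comm)
      ultimately show ?thesis by blast
    qed simp
  qed
  moreover have finU: "finite U" using fin by (simp add: U_def)
  ultimately have "card {x \<in> carrier R. x [^] d = \<ominus> x} \<le> card (insert \<zero> ((\<lambda>u. u \<otimes> z) ` U))"
    by (intro card_mono) auto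
  also have "\<dots> \<le> Suc (card U)"
    using finU card_image_le[OF finU, of "\<lambda>u. u \<otimes> z"] by (simp add: card_insert_if)
  also have "card U \<le> d - 1" unfolding U_def using fin d by (intro num_roots_le_deg) auto
  finally show ?thesis using d by simp
qed

section \<open>Orthogonal colourings of the Paley graph\<close>

lemma orthogonal_colouring_card_le:
  assumes fin: "finite (pverts G)" and k: "k \<ge> 2" and c: "orthogonal_colouring G k n c"
  shows "card (pverts G) \<le> n ^ 2"
proof -
  have "orthogonal_colourings G (c 0) (c 1)"
    using c k by (simp add: orthogonal_colouring_def)
  then have "inj_on (\<lambda>v. (c 0 v, c 1 v)) (pverts G)"
    by (auto simp: orthogonal_colourings_def inj_on_def)
  moreover have "(\<lambda>v. (c 0 v, c 1 v)) ` pverts G \<subseteq> {..<n} \<times> {..<n}"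
    using c k by (auto simp: orthogonal_colouring_def proper_colouring_def)
  ultimately have "card (pverts G) \<le> card ({..<n} \<times> {..<n})"
    by (intro card_inj_on_le) auto
  then show ?thesis by (simp add: power2_eq_square)
qed

text \<open>The two sides of the hypothesis are the exponents that arise when
  \<open>(a [^] m) [^] q \<otimes> a [^] n\<close> is compared with
  \<open>a [^] m \<otimes> (a [^] n) [^] q\<close>. Their difference is
  \<open>(q - 1) * (m - n)\<close>, so the factor \<open>q - 1\<close> of the modulus cancels;
  integers are used because \<open>m - n\<close> may be negative.\<close>

lemma cong_of_conjugate_exponents:
  fixes q m n :: nat
  assumes q: "q > 1" and "[q * m + n = m + q * n] (mod (q ^ 2 - 1))"
  shows "[m = n] (mod (q + 1))"
proof -
  have "[int (q * m + n) = int (m + q * n)] (mod int (q ^ 2 - 1))"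
    using assms(2) by (simp only: cong_int_iff)
  moreover have "int (q ^ 2 - 1) = (int q - 1) * int (q + 1)"
    using q by (simp add: of_nat_diff power2_eq_square algebra_simps)
  moreover have "int (q * m + n) - int (m + q * n) = (int q - 1) * (int m - int n)"
    by (simp add: algebra_simps)
  ultimately have "(int q - 1) * int (q + 1) dvd (int q - 1) * (int m - int n)"
    by (simp add: cong_iff_dvd_diff)
  then have "int (q + 1) dvd int m - int n" using q by simp
  then show ?thesis by (metis cong_iff_dvd_diff cong_int_iff)
qed

lemma (in field) paley_orthogonal_colouring:
  assumes p: "Factorial_Ring.prime p" and oddp: "odd p" and r: "r \<ge> 1"
    and card: "card (carrier R) = p ^ (2 * r)"
  shows "\<exists>c. orthogonal_colouring (paley_graph R) ((p ^ r + 1) div 2) (p ^ r) c"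
proof -
  define q where "q = p ^ r"
  have q1: "q > 1" unfolding q_def using prime_gt_1_nat[OF p] r by (intro one_less_power) auto
  have oddq: "odd q" using oddp by (simp add: q_def)
  have cq: "card (carrier R) = q ^ 2" using card by (simp add: q_def power_mult[symmetric] mult.commute)
  have fin: "finite (carrier R)" using cq q1 by (intro card_ge_0_finite) simp
  have char: "[p] \<cdot> \<one> = \<zero>" using card by (rule char_of_prime_power_card)
  have frob: "(x \<ominus> y) [^] q = x [^] q \<ominus> y [^] q" if "x \<in> carrier R" "y \<in> carrier R" for x y
    unfolding q_def using p char that by (rule frobenius_power_minus)
  have frob2: "(x [^] q) [^] q = x" if "x \<in> carrier R" for x
    using pow_card[OF fin that] that by (simp add: nat_pow_pow cq power2_eq_square)
  obtain a where a: "a \<in> carrier (mult_of R)"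
    and gen: "carrier (mult_of R) = {a [^] i | i :: nat. i \<in> UNIV}"
    using finite_field_mult_group_has_gen[OF fin] by blast
  have ac: "a \<in> carrier R" using a by simp
  define S where "S = {x \<in> carrier R. x [^] q = \<ominus> x}"
  define L where "L b v = v [^] q \<otimes> b \<ominus> v \<otimes> b [^] q" for b v
  have L_S: "L b v \<in> S" if "b \<in> carrier R" "v \<in> carrier R" for b v
  proof -
    \<comment> \<open>Raising to the power \<open>q\<close> is an involution by
      \<open>frob2\<close>, so it exchanges the two terms of \<open>L b v\<close>.\<close>
    have "L b v [^] q = v \<otimes> b [^] q \<ominus> v [^] q \<otimes> b"
      using that by (simp add: L_def frob nat_pow_distrib frob2)
    also have "\<dots> = \<ominus> L b v"
      unfolding L_def using that nat_pow_closed[of v q] nat_pow_closed[of b q] by algebra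
    finally show ?thesis using that by (simp add: S_def L_def)
  qed
  have L_eq: "L b (u \<ominus> v) = \<zero>"
    if "b \<in> carrier R" "u \<in> carrier R" "v \<in> carrier R" "L b u = L b v" for b u v
  proof -
    have "L b (u \<ominus> v) = L b u \<ominus> L b v"
      unfolding L_def frob[OF that(2,3)]
      using that(1-3) nat_pow_closed[of v q] nat_pow_closed[of u q] nat_pow_closed[of b q]
      by algebra
    then show ?thesis using that by (simp add: L_def)
  qed
  \<comment> \<open>A direction, that is a line through zero, is determined by the exponent of
    \<open>a\<close> modulo \<open>q + 1\<close>: two powers of \<open>a\<close> on the same line
    have congruent exponents.\<close>
  have key: "[m = n] (mod (q + 1))" if "L (a [^] n) (a [^] m) = \<zero>" for m n :: nat
  proof -
    have "(a [^] m) [^] q \<otimes> a [^] n = a [^] m \<otimes> (a [^] n) [^] q"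
      using that ac by (simp add: L_def)
    then have "a [^] (q * m + n) = a [^] (m + q * n)"
      using ac by (simp add: nat_pow_pow nat_pow_mult mult.commute)
    then show ?thesis
      using generator_pow_eq_imp_cong[OF fin a gen] cong_of_conjugate_exponents[OF q1] cq by metis
  qed
  have "finite S" "card S \<le> q"
    using fin card_pow_eq_uminus_le[OF fin q1] by (auto simp: S_def)
  \<comment> \<open>\<open>f\<close> turns the at most \<open>q\<close> values of the maps
    \<open>L b\<close> into colours below \<open>q\<close>, losing no information.\<close>
  then obtain f where f: "inj_on f S" "f ` S \<subseteq> {..<q}"
    using card_le_inj[of S "{..<q}"] by auto
  \<comment> \<open>Odd powers of the generator are nonsquares, and for
    \<open>i < (q + 1) div 2\<close> the exponents \<open>2 * i + 1\<close> run through the odd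
    residues modulo \<open>q + 1\<close>, one for each nonsquare direction.\<close>
  define b where "b i = a [^] (2 * i + 1)" for i :: nat
  have b: "b i \<in> carrier R" for i using ac by (simp add: b_def)
  define c where "c i v = f (L (b i) v)" for i v
  have cD: "L (b i) (u \<ominus> v) = \<zero>"
    if "u \<in> carrier R" "v \<in> carrier R" "c i u = c i v" for i u v
    using that f(1) L_S b by (intro L_eq) (auto simp: c_def dest: inj_onD)
  have "proper_colouring (paley_graph R) q (c i)" for i
    unfolding proper_colouring_def
  proof (intro conjI ballI)
    fix v assume "v \<in> pverts (paley_graph R)"
    then show "c i v < q" using f(2) L_S[OF b]
      by (auto simp: c_def paley_graph_def additive_cayley_graph_def)
  next
    fix e assume e: "e \<in> parcs (paley_graph R)"
    have "c i u \<noteq> c i v" if uv: "(u, v) \<in> parcs (paley_graph R)" for u v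
    proof
      assume eq: "c i u = c i v"
      from uv obtain x where uvc: "u \<in> carrier R" "v \<in> carrier R"
        and x: "x \<in> carrier (mult_of R)" "u \<ominus> v = x \<otimes> x"
        by (auto simp: paley_graph_def additive_cayley_graph_def nonzero_squares_def)
      obtain m :: nat where m: "x = a [^] m" using x(1) gen by auto
      have "u \<ominus> v = a [^] (2 * m)" using x m ac by (simp add: nat_pow_mult mult_2)
      then have "[2 * m = 2 * i + 1] (mod (q + 1))"
        using cD[OF uvc eq] by (intro key) (simp add: b_def)
      \<comment> \<open>As \<open>q + 1\<close> is even, congruence modulo \<open>q + 1\<close>
        preserves parity, so a square cannot lie on a nonsquare line.\<close>
      then have "[2 * m = 2 * i + 1] (mod 2)"
        using oddq by (elim cong_dvd_modulus_nat) simp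
      then show False by (simp add: cong_def)
    qed
    then show "case e of (u, v) \<Rightarrow> c i u \<noteq> c i v" using e by (cases e) auto
  qed
  moreover have "orthogonal_colourings (paley_graph R) (c i) (c j)"
    if ij: "i < (q + 1) div 2" "j < (q + 1) div 2" "i \<noteq> j" for i j
  proof -
    have "u = v"
      if uv: "u \<in> carrier R" "v \<in> carrier R" and eq: "c i u = c i v" "c j u = c j v" for u v
    proof (rule ccontr)
      assume "u \<noteq> v"
      then have "u \<ominus> v \<in> carrier (mult_of R)" using uv by (simp add: r_right_minus_eq)
      then obtain m :: nat where m: "u \<ominus> v = a [^] m" using gen by auto
      \<comment> \<open>A nonzero difference of two vertices that agree in both colourings would lie
        on two different lines through zero.\<close>
      have "[m = 2 * i + 1] (mod (q + 1))" "[m = 2 * j + 1] (mod (q + 1))"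
        using key[of "2 * i + 1" m] key[of "2 * j + 1" m] cD[OF uv eq(1)] cD[OF uv eq(2)] m
        by (simp_all add: b_def)
      then have "[2 * i + 1 = 2 * j + 1] (mod (q + 1))"
        using cong_sym cong_trans by blast
      moreover have "2 * i + 1 < q + 1" "2 * j + 1 < q + 1" using ij by auto
      ultimately show False using ij(3) cong_less_modulus_unique_nat by fastforce
    qed
    then show ?thesis
      by (auto simp: orthogonal_colourings_def paley_graph_def additive_cayley_graph_def)
  qed
  ultimately show ?thesis
    unfolding orthogonal_colouring_def q_def[symmetric] by blast
qed

theorem theorem12:
  fixes F :: "('a, 'm) ring_scheme" and p r :: nat
  assumes "Factorial_Ring.prime p" and "odd p" and "r \<ge> 1"
    and "field F" and "card (carrier F) = p ^ (2 * r)"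
  shows "orthogonal_chromatic_number ((p ^ r + 1) div 2) (paley_graph F) = p ^ r"
  unfolding orthogonal_chromatic_number_def
proof (rule Least_equality)
  interpret field F by fact
  show "\<exists>c. orthogonal_colouring (paley_graph F) ((p ^ r + 1) div 2) (p ^ r) c"
    using assms by (intro paley_orthogonal_colouring)
next
  fix n assume "\<exists>c. orthogonal_colouring (paley_graph F) ((p ^ r + 1) div 2) n c"
  then obtain c where c: "orthogonal_colouring (paley_graph F) ((p ^ r + 1) div 2) n c" ..
  have V: "pverts (paley_graph F) = carrier F"
    by (simp add: paley_graph_def additive_cayley_graph_def)
  have fin: "finite (carrier F)"
    using assms by (intro card_ge_0_finite) (simp add: prime_gt_0_nat)
  \<comment> \<open>This ensures at least two colourings, so that a pair of orthogonal ones is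
    available for the counting bound.\<close>
  have "p \<ge> 3" using prime_ge_2_nat[OF assms(1)] assms(2) by (cases "p = 2") auto
  moreover have "p ^ 1 \<le> p ^ r" using assms(1,3) by (intro power_increasing) (auto simp: prime_gt_0_nat Suc_leI)
  ultimately have "(p ^ r + 1) div 2 \<ge> 2" by simp
  then have "card (carrier F) \<le> n ^ 2"
    using orthogonal_colouring_card_le[OF _ _ c] V fin by simp
  then have "(p ^ r) ^ 2 \<le> n ^ 2"
    using assms(5) by (simp add: power_mult[symmetric] mult.commute)
  then show "p ^ r \<le> n" by (simp add: power2_nat_le_eq_le)
qed

end
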